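(* Let $1<p<n$, let $\varphi:(0,+\infty)\to(0,+\infty)$ be a non-decreasing continuous function with $\lim_{t\to 0}\varphi(t)=0$, and let $\xi_\beta:(0,+\infty)\to(0,+\infty)$ be a non-decreasing function with $\lim_{r\to 0}\xi_\beta(r)=0$. Let $V:\mathbb{R}^n\to\mathbb{R}$ belong to the class $S_{p,\varphi}^{\beta}$ with this $\varphi$ and $\xi_\beta$, i.e. for all $r>0$ $$\sup_{x\in\mathbb{R}^n}\int_{|x-y|_\beta<r}\frac{|V(y)|}{|x-y|_\beta^{(n-p)\frac{2|\beta|}{n}}\,\varphi(|x-y|_\beta)}\,dy\le \xi_\beta(r).$$ Then for every $\sigma\in(0,1)$ there exists a non-decreasing, positive function $G(t)$, $t>0$, such that $$\int_{B_\beta(y,r)}G\left(\frac{I_{p,\varphi^\sigma}^{\beta}(f^p)(x)}{\|f\|_p^p}\right)V(x)\,dx\le \xi_\beta(r)$$ for all $f\in C_0^\infty(\mathbb{R}^n)$, $f\not\equiv 0$, and every $\beta$-ball $B_\beta(y,r)$ of radius $r$ containing the support of $f$. Moreover $$\lim_{t\to\infty}\frac{G(t)}{t}=+\infty.$$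
   Context: Fix $\beta=(\beta_1,\dots,\beta_n)$ with $\beta_k\ge \frac12$ for all $k$, and put $|\beta|=\beta_1+\dots+\beta_n$. The $\beta$-distance (non-isotropic distance) on $\mathbb{R}^n$ is $$|x-y|_\beta=\left(|x_1-y_1|^{1/\beta_1}+\dots+|x_n-y_n|^{1/\beta_n}\right)^{|\beta|/n},$$ and $B_\beta(x,r)=\{y\in\mathbb{R}^n:|x-y|_\beta<r\}$ is the open $\beta$-ball with center $x$ and radius $r$. For a positive function $h$ on $(0,+\infty)$ and measurable $g$, the generalized fractional integral generated by the $\beta$-distance is $$I_{p,h}^{\beta}(g)(x)=\int_{\mathbb{R}^n}\frac{|g(y)|}{|x-y|_\beta^{(n-p)\frac{2|\beta|}{n}}\,h(|x-y|_\beta)}\,dy.$$ Here $I_{p,\varphi^\sigma}^\beta$ is taken with $h=\varphi^\sigma$, $f^p$ stands for $|f|^p$, and $\|f\|_p$ is the norm of $L^p(\mathbb{R}^n)$. *)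

theory Defs
  imports "HOL-Analysis.Analysis"
begin

definition beta_sum :: "real^'n \<Rightarrow> real" where
  "beta_sum \<beta> = (\<Sum>k\<in>UNIV. \<beta> $ k)"

definition beta_dist :: "real^'n \<Rightarrow> real^'n \<Rightarrow> real^'n \<Rightarrow> real" where
  "beta_dist \<beta> x y =
     (\<Sum>k\<in>UNIV. \<bar>x $ k - y $ k\<bar> powr (1 / \<beta> $ k)) powr (beta_sum \<beta> / real CARD('n))"

definition beta_ball :: "real^'n \<Rightarrow> real^'n \<Rightarrow> real \<Rightarrow> (real^'n) set" where
  "beta_ball \<beta> x r = {y. beta_dist \<beta> x y < r}"

text \<open>At \<open>y = x\<close> division by zero makes this kernel 0, whatever the value of \<open>h 0\<close>. The
  diagonal is a null set, so the integrals below do not depend on this convention.\<close>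

definition beta_kernel ::
    "real \<Rightarrow> (real \<Rightarrow> real) \<Rightarrow> real^'n \<Rightarrow> real^'n \<Rightarrow> real^'n \<Rightarrow> real" where
  "beta_kernel p h \<beta> x y =
     1 / (beta_dist \<beta> x y powr ((real CARD('n) - p) * (2 * beta_sum \<beta> / real CARD('n)))
          * h (beta_dist \<beta> x y))"

text \<open>The integral of a non-negative function, with values in \<open>[0, \<infinity>]\<close>.\<close>

definition beta_frac_integral ::
    "real \<Rightarrow> (real \<Rightarrow> real) \<Rightarrow> real^'n \<Rightarrow> (real^'n \<Rightarrow> real) \<Rightarrow> real^'n \<Rightarrow> ennreal" where
  "beta_frac_integral p h \<beta> g x =
     (\<integral>\<^sup>+ y. ennreal (\<bar>g y\<bar> * beta_kernel p h \<beta> x y) \<partial>lebesgue)"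

definition beta_S_class ::
    "real \<Rightarrow> (real \<Rightarrow> real) \<Rightarrow> real^'n \<Rightarrow> (real \<Rightarrow> real) \<Rightarrow> (real^'n \<Rightarrow> real) set" where
  "beta_S_class p \<phi> \<beta> \<xi> =
     {V. V \<in> borel_measurable lebesgue \<and>
         (\<forall>r>0. (SUP x. \<integral>\<^sup>+ y\<in>beta_ball \<beta> x r.
                    ennreal (\<bar>V y\<bar> * beta_kernel p \<phi> \<beta> x y) \<partial>lebesgue) \<le> ennreal (\<xi> r))}"

definition Lp_norm :: "real \<Rightarrow> (real^'n \<Rightarrow> real) \<Rightarrow> real" where
  "Lp_norm p f = (LINT x|lebesgue. \<bar>f x\<bar> powr p) powr (1 / p)"

text \<open>\<open>C_k k f\<close>: \<open>f\<close> is \<open>k\<close> times continuously differentiable on the whole space.\<close>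

primrec C_k :: "nat \<Rightarrow> (real^'n \<Rightarrow> real) \<Rightarrow> bool" where
  "C_k 0 f \<longleftrightarrow> continuous_on UNIV f"
| "C_k (Suc k) f \<longleftrightarrow>
     (\<forall>x. f differentiable (at x)) \<and> (\<forall>v. C_k k (\<lambda>x. frechet_derivative f (at x) v))"

definition tsupport :: "(real^'n \<Rightarrow> real) \<Rightarrow> (real^'n) set" where
  "tsupport f = closure {x. f x \<noteq> 0}"

definition test_function :: "(real^'n \<Rightarrow> real) \<Rightarrow> bool" where
  "test_function f \<longleftrightarrow> (\<forall>k. C_k k f) \<and> compact (tsupport f)"

end

theory Submission
  imports Defs
begin

text \<open>
  Put \<open>\<gamma> = (n - p) 2 |\<beta>| / n\<close>, \<open>a(t) = 1 / (t\<^sup>\<gamma> \<phi>(t)\<^sup>\<sigma>)\<close> and \<open>c(t) = \<phi>(t)\<^sup>\<sigma>\<^sup>-\<^sup>1 / 2\<close>. The kernel of the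
  fractional integral is \<open>a\<close> at the distance \<open>|x - z|\<^sub>\<beta>\<close>, and \<open>c a\<close> is half of the kernel
  \<open>K(x, z)\<close> that defines the class of \<open>V\<close>. Both \<open>a\<close> and \<open>c\<close> are decreasing and blow up at \<open>0\<close>;
  for \<open>c\<close> this is where \<open>\<sigma> < 1\<close> enters.

  Thus passing from \<open>a\<close> to \<open>c a\<close> gains the unbounded factor \<open>c\<close>. The function
  \<open>G(s) = sup\<^sub>t c(t) (s - a(t))\<^sup>+\<close> exploits this gain: it is convex, it grows faster than every
  linear function because the slopes \<open>c(t)\<close> are unbounded, and \<open>G(a(t)) \<le> c(t) a(t)\<close> by
  monotonicity. Jensen's inequality for the probability density \<open>|f|\<^sup>p / \<parallel>f\<parallel>\<^sup>p\<close> then gives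
  \<open>G(I(x) / \<parallel>f\<parallel>\<^sup>p) \<le> \<integral> |f(z)|\<^sup>p / \<parallel>f\<parallel>\<^sup>p K(x, z) / 2 dz\<close>. As \<open>G\<close> is a supremum of ramps, this is
  proved directly, by averaging one ramp at a time (\<open>envelope_average\<close>).

  Multiply by \<open>|V|\<close>, integrate over the ball \<open>B(y, r)\<close> and exchange the integrals. It remains to
  bound \<open>\<integral> |V(x)| K(z, x) dx\<close> over \<open>B(y, r)\<close> by \<open>2 \<xi>(r)\<close> for each fixed \<open>z\<close>
  (\<open>beta_S_class_ball_bound\<close>). Points with \<open>|x - z|\<^sub>\<beta> < r\<close> contribute at most \<open>\<xi>(r)\<close>. At the others
  \<open>x\<close> is nearer to \<open>y\<close> than to \<open>z\<close>, so \<open>K(z, x) \<le> K(y, x)\<close> and they too contribute at most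
  \<open>\<xi>(r)\<close>. The factor \<open>1/2\<close> in \<open>c\<close> absorbs the \<open>2\<close>.
\<close>

section \<open>A superlinear convex function from two decreasing profiles\<close>

locale decreasing_pair =
  fixes c a :: "real \<Rightarrow> real"
  assumes c_pos: "0 < t \<Longrightarrow> 0 < c t"
    and a_pos: "0 < t \<Longrightarrow> 0 < a t"
    and c_antimono: "0 < s \<Longrightarrow> s \<le> t \<Longrightarrow> c t \<le> c s"
    and a_antimono: "0 < s \<Longrightarrow> s \<le> t \<Longrightarrow> a t \<le> a s"
    and c_lim_0: "filterlim c at_top (at_right 0)"
    and a_lim_0: "filterlim a at_top (at_right 0)"
    and a_lim_infty: "(a \<longlongrightarrow> 0) at_top"
begin

text \<open>Taking a supremum of ramps makes convexity, monotonicity and growth visible from single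
  ramps.\<close>
definition envelope :: "real \<Rightarrow> real" where
  "envelope s = (SUP t\<in>{0<..}. c t * max 0 (s - a t))"

text \<open>Choose \<open>u\<close> with \<open>a u \<ge> s\<close>. Ramps with \<open>t \<le> u\<close> have not started at \<open>s\<close>; those with \<open>t > u\<close> have
  slope at most \<open>c u\<close>.\<close>
lemma ramps_bdd_above: "bdd_above ((\<lambda>t. c t * max 0 (s - a t)) ` {0<..})"
proof -
  have "eventually (\<lambda>t. s \<le> a t \<and> 0 < t) (at_right 0)"
    using a_lim_0 by (auto simp: filterlim_at_top eventually_at_right_less intro: eventually_conj)
  then obtain u where u: "s \<le> a u" "0 < u"
    by (auto dest!: eventually_happens)
  have "c t * max 0 (s - a t) \<le> c u * max 0 s" if "0 < t" for t
  proof (cases "t \<le> u")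
    case True
    then have "s \<le> a t"
      using a_antimono[OF that True] u(1) by linarith
    then show ?thesis
      using c_pos[OF u(2)] by simp
  next
    case False
    then show ?thesis
      using c_antimono[of u t] a_pos[OF that] c_pos[OF u(2)] u(2)
      by (intro mult_mono) auto
  qed
  then show ?thesis
    by (intro bdd_aboveI2) auto
qed

lemma ramp_le_envelope: "0 < t \<Longrightarrow> c t * max 0 (s - a t) \<le> envelope s"
  unfolding envelope_def by (intro cSUP_upper ramps_bdd_above) simp

lemma envelope_le:
  assumes "\<And>t. 0 < t \<Longrightarrow> c t * max 0 (s - a t) \<le> b"
  shows "envelope s \<le> b"
  unfolding envelope_def using assms by (intro cSUP_least) auto

lemma mono_envelope: "mono envelope"
proof (intro monoI envelope_le)
  fix s s' t :: real
  assume "s \<le> s'" "0 < t"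
  then have "c t * max 0 (s - a t) \<le> c t * max 0 (s' - a t)"
    using c_pos[of t] by (intro mult_left_mono) auto
  also have "\<dots> \<le> envelope s'"
    using \<open>0 < t\<close> by (rule ramp_le_envelope)
  finally show "c t * max 0 (s - a t) \<le> envelope s'" .
qed

lemma envelope_pos:
  assumes "0 < s"
  shows "0 < envelope s"
proof -
  have "eventually (\<lambda>t. a t < s \<and> 0 < t) at_top"
    using order_tendstoD(2)[OF a_lim_infty assms] eventually_gt_at_top[of "0::real"]
    by eventually_elim simp
  then obtain t where t: "a t < s" "0 < t"
    by (auto dest!: eventually_happens)
  then have "0 < c t * max 0 (s - a t)"
    using c_pos by simp
  also have "\<dots> \<le> envelope s"
    using t(2) by (rule ramp_le_envelope)
  finally show ?thesis .
qed

text \<open>A single ramp of slope at least \<open>2 M\<close> exceeds \<open>M s\<close> as soon as \<open>s\<close> is twice its starting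
  point.\<close>
lemma envelope_superlinear: "filterlim (\<lambda>s. envelope s / s) at_top at_top"
  unfolding filterlim_at_top
proof
  fix M :: real
  have "eventually (\<lambda>t. 2 * \<bar>M\<bar> \<le> c t \<and> 0 < t) (at_right 0)"
    using c_lim_0 by (auto simp: filterlim_at_top eventually_at_right_less intro: eventually_conj)
  then obtain t where t: "2 * \<bar>M\<bar> \<le> c t" "0 < t"
    by (auto dest!: eventually_happens)
  show "\<forall>\<^sub>F s in at_top. M \<le> envelope s / s"
    using eventually_ge_at_top[of "2 * a t"]
  proof eventually_elim
    case (elim s)
    have "0 < s"
      using elim a_pos[OF t(2)] by linarith
    have "M * s \<le> 2 * \<bar>M\<bar> * (s / 2)"
      using \<open>0 < s\<close> by (simp add: mult_right_mono)
    also have "\<dots> \<le> c t * max 0 (s - a t)"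
      using t elim \<open>0 < s\<close> by (intro mult_mono) auto
    also have "\<dots> \<le> envelope s"
      using t(2) by (rule ramp_le_envelope)
    finally show ?case
      using \<open>0 < s\<close> by (simp add: pos_le_divide_eq)
  qed
qed

text \<open>Jensen's inequality combined with \<open>envelope (a t) \<le> c t * a t\<close>. For one ramp, with parameter
  \<open>t\<close>, everything rests on \<open>c t * a \<tau> \<le> c \<tau> * a \<tau> + c t * a t\<close>: replace \<open>c t\<close> by \<open>c \<tau>\<close> if
  \<open>\<tau> \<le> t\<close>, and \<open>a \<tau>\<close> by \<open>a t\<close> otherwise. Averaging over \<open>\<tau>\<close> with total weight \<open>1\<close> bounds the ramp
  at the mean of \<open>a\<close> by the mean of \<open>c a\<close>. The same estimate shows that a finite mean of \<open>c a\<close>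
  forces a finite mean of \<open>a\<close>, so that \<open>enn2real\<close> loses nothing.\<close>
lemma envelope_average:
  fixes M :: "'b measure" and w \<tau> :: "'b \<Rightarrow> real"
  assumes w: "w \<in> borel_measurable M" "\<And>z. 0 \<le> w z" "(\<integral>\<^sup>+ z. ennreal (w z) \<partial>M) = 1"
    and \<tau>: "AE z in M. 0 < \<tau> z"
    and meas: "(\<lambda>z. a (\<tau> z)) \<in> borel_measurable M" "(\<lambda>z. c (\<tau> z) * a (\<tau> z)) \<in> borel_measurable M"
    and fin: "(\<integral>\<^sup>+ z. ennreal (w z * (c (\<tau> z) * a (\<tau> z))) \<partial>M) < \<infinity>"
  shows "(\<integral>\<^sup>+ z. ennreal (w z * a (\<tau> z)) \<partial>M) < \<infinity>"
    and "ennreal (envelope (enn2real (\<integral>\<^sup>+ z. ennreal (w z * a (\<tau> z)) \<partial>M)))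
           \<le> (\<integral>\<^sup>+ z. ennreal (w z * (c (\<tau> z) * a (\<tau> z))) \<partial>M)"
proof -
  define I where "I = (\<integral>\<^sup>+ z. ennreal (w z * a (\<tau> z)) \<partial>M)"
  define J where "J = (\<integral>\<^sup>+ z. ennreal (w z * (c (\<tau> z) * a (\<tau> z))) \<partial>M)"
  note [measurable] = w(1) meas
  have key: "ennreal (c t) * I \<le> J + ennreal (c t * a t)" if "0 < t" for t
  proof -
    have "ennreal (c t) * I = (\<integral>\<^sup>+ z. ennreal (c t) * ennreal (w z * a (\<tau> z)) \<partial>M)"
      unfolding I_def by (subst nn_integral_cmult) auto
    also have "\<dots> \<le> (\<integral>\<^sup>+ z. ennreal (w z * (c (\<tau> z) * a (\<tau> z))) + ennreal (c t * a t) * ennreal (w z) \<partial>M)"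
    proof (rule nn_integral_mono_AE, use \<tau> in eventually_elim)
      case (elim z)
      have nn: "0 \<le> c (\<tau> z) * a (\<tau> z)" "0 \<le> c t * a t"
        using c_pos[OF elim] a_pos[OF elim] c_pos[OF that] a_pos[OF that] by simp_all
      have "c t * a (\<tau> z) \<le> c (\<tau> z) * a (\<tau> z) + c t * a t"
      proof (cases "\<tau> z \<le> t")
        case True
        have "c t * a (\<tau> z) \<le> c (\<tau> z) * a (\<tau> z)"
          using c_antimono[OF elim True] a_pos[OF elim] by (intro mult_right_mono) auto
        then show ?thesis using nn by linarith
      next
        case False
        have "c t * a (\<tau> z) \<le> c t * a t"
          using a_antimono[OF that, of "\<tau> z"] False c_pos[OF that] by (intro mult_left_mono) auto
        then show ?thesis using nn by linarith
      qed
      then have "w z * (c t * a (\<tau> z)) \<le> w z * (c (\<tau> z) * a (\<tau> z) + c t * a t)"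
        by (intro mult_left_mono w(2))
      then have "ennreal (c t * (w z * a (\<tau> z)))
          \<le> ennreal (w z * (c (\<tau> z) * a (\<tau> z)) + c t * a t * w z)"
        by (intro ennreal_leI) (simp add: algebra_simps)
      also have "\<dots> = ennreal (w z * (c (\<tau> z) * a (\<tau> z))) + ennreal (c t * a t) * ennreal (w z)"
        using nn w(2)[of z] by (simp add: ennreal_plus ennreal_mult)
      finally show ?case
        using c_pos[OF that] by (subst ennreal_mult'[symmetric]) auto
    qed
    also have "\<dots> = J + ennreal (c t * a t)"
      unfolding J_def by (subst nn_integral_add) (auto simp: nn_integral_cmult w(3))
    finally show ?thesis .
  qed
  have J_fin: "J < \<infinity>" using fin unfolding J_def .
  have "ennreal (c 1) * I < \<infinity>"
    using le_less_trans[OF key[of 1]] J_fin by simp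
  then have I_fin: "I < \<infinity>"
    using c_pos[of 1] by (auto simp: ennreal_mult_less_top)
  then show "(\<integral>\<^sup>+ z. ennreal (w z * a (\<tau> z)) \<partial>M) < \<infinity>" unfolding I_def .
  have "c t * max 0 (enn2real I - a t) \<le> enn2real J" if "0 < t" for t
  proof -
    have "ennreal (c t * enn2real I) \<le> ennreal (enn2real J + c t * a t)"
      using key[OF that] I_fin J_fin c_pos[OF that] a_pos[OF that]
      by (simp add: ennreal_mult ennreal_plus)
    then have "c t * enn2real I \<le> enn2real J + c t * a t"
      using c_pos[OF that] a_pos[OF that] by (subst (asm) ennreal_le_iff) auto
    then show ?thesis
      by (auto simp: max_def algebra_simps)
  qed
  then have "envelope (enn2real I) \<le> enn2real J"
    by (rule envelope_le)
  then have "ennreal (envelope (enn2real I)) \<le> ennreal (enn2real J)"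
    by (rule ennreal_leI)
  also have "ennreal (enn2real J) = J"
    using J_fin by (simp add: less_top[symmetric])
  finally show "ennreal (envelope (enn2real (\<integral>\<^sup>+ z. ennreal (w z * a (\<tau> z)) \<partial>M)))
      \<le> (\<integral>\<^sup>+ z. ennreal (w z * (c (\<tau> z) * a (\<tau> z))) \<partial>M)"
    unfolding I_def[symmetric] J_def[symmetric] .
qed

end

section \<open>Two measure-theoretic facts\<close>

text \<open>This makes Tonelli's theorem available for the completed Lebesgue measure, which is the
  one that makes \<open>V\<close> measurable.\<close>
lemma sigma_finite_completion:
  assumes "sigma_finite_measure M"
  shows "sigma_finite_measure (completion M)"
proof
  obtain A where A: "countable A" "A \<subseteq> sets M" "\<Union> A = space M" "\<forall>a\<in>A. emeasure M a \<noteq> \<infinity>"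
    using sigma_finite_measure.sigma_finite_countable[OF assms] by auto
  have "\<forall>a\<in>A. emeasure (completion M) a \<noteq> \<infinity>"
    using A(2,4) by (auto simp: subset_iff emeasure_completion)
  then show "\<exists>A. countable A \<and> A \<subseteq> sets (completion M) \<and> \<Union> A = space (completion M) \<and>
             (\<forall>a\<in>A. emeasure (completion M) a \<noteq> \<infinity>)"
    using A by (intro exI[of _ A]) (auto intro: sets_completionI_sets)
qed

lemma nn_integral_pos_of_open:
  fixes g :: "'a::euclidean_space \<Rightarrow> real"
  assumes [measurable]: "g \<in> borel_measurable lebesgue"
    and U: "open U" "U \<noteq> {}" and pos: "AE x in lebesgue. x \<in> U \<longrightarrow> 0 < g x"
  shows "0 < (\<integral>\<^sup>+ x. ennreal (g x) \<partial>lebesgue)"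
proof (rule ccontr)
  assume "\<not> ?thesis"
  then have "AE x in lebesgue. ennreal (g x) = 0"
    by (subst (asm) not_gr_zero, subst (asm) nn_integral_0_iff_AE) auto
  with pos have "AE x in lebesgue. x \<notin> U"
    by eventually_elim (auto simp: ennreal_eq_0_iff)
  then have "U \<in> null_sets lebesgue"
    using U(1) by (subst (asm) AE_iff_null_sets[symmetric]) auto
  then show False
    using open_not_negligible[OF U] by (simp add: negligible_iff_null_sets)
qed

section \<open>Radial profiles of the kernels\<close>

definition power_profile :: "real \<Rightarrow> (real \<Rightarrow> real) \<Rightarrow> real \<Rightarrow> real" where
  "power_profile \<gamma> h t = 1 / (t powr \<gamma> * h t)"

lemma power_profile_pos:
  "0 < t \<Longrightarrow> 0 < h t \<Longrightarrow> 0 < power_profile \<gamma> h t"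
  by (simp add: power_profile_def)

lemma power_profile_antimono:
  assumes "0 < s" "s \<le> t" "0 < h s" "h s \<le> h t" "0 \<le> \<gamma>"
  shows "power_profile \<gamma> h t \<le> power_profile \<gamma> h s"
  unfolding power_profile_def using assms
  by (intro divide_left_mono mult_mono mult_pos_pos powr_mono2) auto

text \<open>The product of the two profiles is \<open>b\<close> times the profile with exponent \<open>1\<close> in place of \<open>\<sigma>\<close>.
  The slopes blow up at \<open>0\<close> because \<open>\<sigma> - 1 < 0\<close>; the kernel vanishes at infinity because
  \<open>t powr \<gamma>\<close> grows and \<open>\<phi>\<close> stays above \<open>\<phi> 1\<close> there.\<close>
lemma decreasing_pair_power_profile:
  fixes \<phi> :: "real \<Rightarrow> real"
  assumes \<gamma>: "0 < \<gamma>" and \<sigma>: "0 < \<sigma>" "\<sigma> < 1" and b: "0 < b"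
    and pos: "\<And>t. 0 < t \<Longrightarrow> 0 < \<phi> t"
    and mono: "mono_on {0<..} \<phi>"
    and lim: "(\<phi> \<longlongrightarrow> 0) (at_right 0)"
  shows "decreasing_pair (\<lambda>t. b * \<phi> t powr (\<sigma> - 1)) (power_profile \<gamma> (\<lambda>t. \<phi> t powr \<sigma>))"
proof
  have \<phi>_le: "\<phi> s \<le> \<phi> t" if "0 < s" "s \<le> t" for s t
    using mono_onD[OF mono, of s t] that by auto
  have right: "\<forall>\<^sub>F t::real in at_right 0. 0 < t"
    by (simp add: eventually_at_right_less)
  show "0 < b * \<phi> t powr (\<sigma> - 1)" if "0 < t" for t
    using b pos[OF that] by simp
  show "0 < power_profile \<gamma> (\<lambda>t. \<phi> t powr \<sigma>) t" if "0 < t" for t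
    using pos[OF that] that by (simp add: power_profile_pos)
  show "b * \<phi> t powr (\<sigma> - 1) \<le> b * \<phi> s powr (\<sigma> - 1)" if "0 < s" "s \<le> t" for s t
    using b \<phi>_le[OF that] pos[OF that(1)] \<sigma> by (intro mult_left_mono powr_mono2') auto
  show "power_profile \<gamma> (\<lambda>t. \<phi> t powr \<sigma>) t \<le> power_profile \<gamma> (\<lambda>t. \<phi> t powr \<sigma>) s"
    if "0 < s" "s \<le> t" for s t
    using that \<phi>_le[OF that] pos[OF that(1)] \<gamma> \<sigma> by (intro power_profile_antimono powr_mono2) auto
  have \<phi>_powr: "((\<lambda>t. \<phi> t powr e) \<longlongrightarrow> 0) (at_right 0)" if "0 < e" for e
    by (rule tendsto_zero_powrI[OF lim tendsto_const _ that], use right in eventually_elim)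
      (use pos in \<open>auto intro: less_imp_le\<close>)
  have "filterlim (\<lambda>t. inverse (\<phi> t powr (1 - \<sigma>))) at_top (at_right 0)"
    by (rule filterlim_inverse_at_top, rule \<phi>_powr, use \<sigma> in simp, use right in eventually_elim)
      (use pos in \<open>force\<close>)
  then have "filterlim (\<lambda>t. \<phi> t powr (\<sigma> - 1)) at_top (at_right 0)"
    using \<sigma> by (simp add: powr_minus[symmetric])
  then show "filterlim (\<lambda>t. b * \<phi> t powr (\<sigma> - 1)) at_top (at_right 0)"
    by (rule filterlim_tendsto_pos_mult_at_top[OF tendsto_const b])
  have "((\<lambda>t::real. t powr \<gamma>) \<longlongrightarrow> 0) (at_right 0)"
    by (rule tendsto_zero_powrI[OF tendsto_ident_at tendsto_const _ \<gamma>], use right in eventually_elim) simp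
  from tendsto_mult[OF this \<phi>_powr[OF \<sigma>(1)]]
  have "filterlim (\<lambda>t. inverse (t powr \<gamma> * \<phi> t powr \<sigma>)) at_top (at_right 0)"
    by (intro filterlim_inverse_at_top, simp, use right in eventually_elim) (use pos in force)
  then show "filterlim (power_profile \<gamma> (\<lambda>t. \<phi> t powr \<sigma>)) at_top (at_right 0)"
    by (simp add: power_profile_def[abs_def] inverse_eq_divide)
  show "(power_profile \<gamma> (\<lambda>t. \<phi> t powr \<sigma>) \<longlongrightarrow> 0) at_top"
  proof (rule tendsto_sandwich)
    show "\<forall>\<^sub>F t in at_top. 0 \<le> power_profile \<gamma> (\<lambda>t. \<phi> t powr \<sigma>) t"
      using eventually_gt_at_top[of 0]
      by eventually_elim (use pos in \<open>simp add: power_profile_def\<close>)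
    show "\<forall>\<^sub>F t in at_top. power_profile \<gamma> (\<lambda>t. \<phi> t powr \<sigma>) t \<le> 1 / (t powr \<gamma> * \<phi> 1 powr \<sigma>)"
      using eventually_ge_at_top[of 1]
    proof eventually_elim
      case (elim t)
      then show ?case
        unfolding power_profile_def using \<phi>_le[of 1 t] pos[of 1] pos[of t] \<sigma>
        by (intro divide_left_mono mult_left_mono mult_pos_pos powr_mono2) auto
    qed
    have "((\<lambda>t. (1 / \<phi> 1 powr \<sigma>) * t powr (- \<gamma>)) \<longlongrightarrow> (1 / \<phi> 1 powr \<sigma>) * 0) at_top"
      by (intro tendsto_mult tendsto_const tendsto_neg_powr filterlim_ident) (use \<gamma> in simp)
    then show "((\<lambda>t. 1 / (t powr \<gamma> * \<phi> 1 powr \<sigma>)) \<longlongrightarrow> 0) at_top"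
      by (simp add: powr_minus divide_simps mult.commute)
  qed (rule tendsto_const)
qed

section \<open>The \<open>\<beta>\<close>-distance and its kernels\<close>

lemma beta_kernel_eq_power_profile:
  "beta_kernel p h \<beta> x (y::real^'n) =
     power_profile ((real CARD('n) - p) * (2 * beta_sum \<beta> / real CARD('n))) h (beta_dist \<beta> x y)"
  by (simp add: beta_kernel_def power_profile_def)

lemma beta_dist_commute: "beta_dist \<beta> x y = beta_dist \<beta> y x"
  by (simp add: beta_dist_def abs_minus_commute)

lemma beta_kernel_commute: "beta_kernel p h \<beta> x y = beta_kernel p h \<beta> y x"
  by (simp add: beta_kernel_def beta_dist_commute[of \<beta> x y])

lemma beta_dist_nonneg: "0 \<le> beta_dist \<beta> x y"
  by (simp add: beta_dist_def)

lemma beta_dist_pos: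
  fixes x y :: "real^'n"
  assumes "x \<noteq> y"
  shows "0 < beta_dist \<beta> x y"
proof -
  obtain k where "x $ k \<noteq> y $ k" using assms by (auto simp: vec_eq_iff)
  then have "0 < (\<Sum>k\<in>UNIV. \<bar>x $ k - y $ k\<bar> powr (1 / \<beta> $ k))"
    by (intro sum_pos2[of UNIV k]) auto
  then show ?thesis by (simp add: beta_dist_def)
qed

lemma beta_dist_measurable [measurable]:
  fixes f g :: "'b \<Rightarrow> real^'n"
  assumes [measurable]: "f \<in> borel_measurable M" "g \<in> borel_measurable M"
  shows "(\<lambda>x. beta_dist \<beta> (f x) (g x)) \<in> borel_measurable M"
proof -
  have "(\<lambda>x. u x $ k) \<in> borel_measurable M"
    if "u \<in> borel_measurable M" for k and u :: "'b \<Rightarrow> real^'n"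
    using that by (rule measurable_compose)
      (intro borel_measurable_continuous_onI continuous_intros)
  then show ?thesis unfolding beta_dist_def by measurable
qed

lemma beta_kernel_measurable:
  fixes f g :: "'b \<Rightarrow> real^'n"
  assumes h: "continuous_on {0<..} h" "\<And>t. 0 < t \<Longrightarrow> 0 < h t"
    and [measurable]: "f \<in> borel_measurable M" "g \<in> borel_measurable M"
  shows "(\<lambda>x. beta_kernel p h \<beta> (f x) (g x)) \<in> borel_measurable M"
proof -
  define \<gamma> where "\<gamma> = (real CARD('n) - p) * (2 * beta_sum \<beta> / real CARD('n))"
  have "continuous_on {0<..} (power_profile \<gamma> h)"
    unfolding power_profile_def using h
    by (intro continuous_intros) (auto simp: less_imp_neq[symmetric])
  then have [measurable]: "(\<lambda>t. indicator {0<..} t *\<^sub>R power_profile \<gamma> h t) \<in> borel_measurable borel"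
    by (intro borel_measurable_continuous_on_indicator) auto
  \<comment> \<open>At distance \<open>0\<close> the kernel is \<open>0\<close> by division by zero, so cutting the profile off to \<open>{0<..}\<close>
      changes nothing; elsewhere it is continuous.\<close>
  have "beta_kernel p h \<beta> (f x) (g x) =
      (\<lambda>t. indicator {0<..} t *\<^sub>R power_profile \<gamma> h t) (beta_dist \<beta> (f x) (g x))" for x
    using beta_dist_nonneg[of \<beta> "f x" "g x"]
    by (cases "beta_dist \<beta> (f x) (g x) = 0")
      (auto simp: beta_kernel_eq_power_profile \<gamma>_def indicator_def power_profile_def)
  then show ?thesis
    by (simp only: cong: measurable_cong) measurable
qed

text \<open>The class bounds only integrals over a ball centred at the pole of the kernel. Off the ball
  around \<open>z\<close>, the monotone kernel with pole \<open>z\<close> is dominated on \<open>beta_ball \<beta> y r\<close> by the one with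
  pole \<open>y\<close>; two applications of the hypothesis therefore suffice.\<close>
lemma beta_S_class_ball_bound:
  fixes \<beta> :: "real^'n"
  assumes V: "V \<in> beta_S_class p \<phi> \<beta> \<xi>"
    and \<beta>: "0 \<le> beta_sum \<beta>" and p: "p \<le> real CARD('n)"
    and pos: "\<And>t. 0 < t \<Longrightarrow> 0 < \<phi> t"
    and mono: "mono_on {0<..} \<phi>" and cont: "continuous_on {0<..} \<phi>"
    and r: "0 < r"
  shows "(\<integral>\<^sup>+ x\<in>beta_ball \<beta> y r. ennreal (\<bar>V x\<bar> * beta_kernel p \<phi> \<beta> z x) \<partial>lebesgue) \<le> 2 * ennreal (\<xi> r)"
proof -
  have V_meas [measurable]: "V \<in> borel_measurable lebesgue"
    using V by (simp add: beta_S_class_def)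
  have bound: "(\<integral>\<^sup>+ x\<in>beta_ball \<beta> y r. ennreal (\<bar>V x\<bar> * beta_kernel p \<phi> \<beta> y x) \<partial>lebesgue) \<le> ennreal (\<xi> r)" for y
    using V r unfolding beta_S_class_def by (auto simp: SUP_le_iff)
  have id: "(\<lambda>x. x) \<in> borel_measurable (lebesgue :: (real^'n) measure)"
    by (intro measurable_completion[of "\<lambda>x. x" lborel]) simp
  have [measurable]: "(\<lambda>x. beta_kernel p \<phi> \<beta> y x) \<in> borel_measurable lebesgue" for y
    by (intro beta_kernel_measurable cont pos id) auto
  have dist_meas: "(\<lambda>x. beta_dist \<beta> y x) \<in> borel_measurable lebesgue" for y
    by (intro beta_dist_measurable id) auto
  have [measurable]: "beta_ball \<beta> y r \<in> sets lebesgue" for y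
    using measurable_sets[OF dist_meas, of "{..<r}" y] by (simp add: beta_ball_def vimage_def lessThan_def)
  let ?k = "\<lambda>w x. ennreal (\<bar>V x\<bar> * beta_kernel p \<phi> \<beta> w x) * indicator (beta_ball \<beta> w r) x"
  have "ennreal (\<bar>V x\<bar> * beta_kernel p \<phi> \<beta> z x) * indicator (beta_ball \<beta> y r) x \<le> ?k z x + ?k y x"
    if "x \<noteq> y" for x
  proof (cases "x \<in> beta_ball \<beta> y r \<and> x \<notin> beta_ball \<beta> z r")
    case True
    then have d: "beta_dist \<beta> y x \<le> beta_dist \<beta> z x" "0 < beta_dist \<beta> y x"
      using beta_dist_pos[of y x] that by (auto simp: beta_ball_def)
    have "beta_kernel p \<phi> \<beta> z x \<le> beta_kernel p \<phi> \<beta> y x"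
      unfolding beta_kernel_eq_power_profile
      using d mono_onD[OF mono, of "beta_dist \<beta> y x" "beta_dist \<beta> z x"] \<beta> p pos[OF d(2)]
      by (intro power_profile_antimono) auto
    then show ?thesis
      using True by (auto intro!: ennreal_leI mult_left_mono)
  qed (auto simp: indicator_def)
  then have "(\<integral>\<^sup>+ x\<in>beta_ball \<beta> y r. ennreal (\<bar>V x\<bar> * beta_kernel p \<phi> \<beta> z x) \<partial>lebesgue)
      \<le> (\<integral>\<^sup>+ x. ?k z x + ?k y x \<partial>lebesgue)"
    by (intro nn_integral_mono_AE AE_completion eventually_mono[OF AE_lborel_singleton[of y]]) auto
  also have "\<dots> = (\<integral>\<^sup>+ x. ?k z x \<partial>lebesgue) + (\<integral>\<^sup>+ x. ?k y x \<partial>lebesgue)"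
    by (rule nn_integral_add) measurable
  also have "\<dots> \<le> ennreal (\<xi> r) + ennreal (\<xi> r)"
    by (intro add_mono bound)
  finally show ?thesis by (simp add: mult_2)
qed

section \<open>The embedding theorem\<close>

lemma test_function_powr:
  fixes f :: "real^'n \<Rightarrow> real"
  assumes f: "test_function f" and p: "0 < p"
  shows "continuous_on UNIV (\<lambda>x. \<bar>f x\<bar> powr p)" and "integrable lebesgue (\<lambda>x. \<bar>f x\<bar> powr p)"
proof -
  have "C_k 0 f" using f by (simp only: test_function_def)
  then have [continuous_intros]: "continuous_on UNIV f" by simp
  show cont: "continuous_on UNIV (\<lambda>x. \<bar>f x\<bar> powr p)"
    using p by (intro continuous_on_powr' continuous_intros) auto
  have "integrable lborel (\<lambda>x. indicator (tsupport f) x *\<^sub>R \<bar>f x\<bar> powr p)"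
    using f by (intro borel_integrable_compact continuous_on_subset[OF cont])
      (auto simp: test_function_def)
  also have "(\<lambda>x. indicator (tsupport f) x *\<^sub>R \<bar>f x\<bar> powr p) = (\<lambda>x. \<bar>f x\<bar> powr p)"
    using closure_subset[of "{x. f x \<noteq> 0}"] by (auto simp: fun_eq_iff indicator_def tsupport_def)
  finally show "integrable lebesgue (\<lambda>x. \<bar>f x\<bar> powr p)"
    by (intro integrable_completion[THEN iffD2] borel_measurable_integrable)
qed

theorem theorem1:
  fixes \<beta> :: "real^'n" and p :: real and \<phi> \<xi> :: "real \<Rightarrow> real" and V :: "real^'n \<Rightarrow> real"
    and \<sigma> :: real
  assumes "\<And>k. \<beta> $ k \<ge> 1 / 2"
    and "1 < p" and "p < real CARD('n)"
    and "\<And>t. 0 < t \<Longrightarrow> 0 < \<phi> t"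
    and "mono_on {0<..} \<phi>"
    and "continuous_on {0<..} \<phi>"
    and "(\<phi> \<longlongrightarrow> 0) (at_right 0)"
    and "\<And>r. 0 < r \<Longrightarrow> 0 < \<xi> r"
    and "mono_on {0<..} \<xi>"
    and "(\<xi> \<longlongrightarrow> 0) (at_right 0)"
    and "V \<in> beta_S_class p \<phi> \<beta> \<xi>"
    and "0 < \<sigma>" and "\<sigma> < 1"
  shows "\<exists>G :: real \<Rightarrow> real.
           mono_on {0<..} G \<and> (\<forall>t>0. 0 < G t) \<and>
           (\<forall>f y r. test_function f \<and> (\<exists>x. f x \<noteq> 0) \<and> 0 < r \<and> tsupport f \<subseteq> beta_ball \<beta> y r \<longrightarrow>
              (let I = beta_frac_integral p (\<lambda>t. \<phi> t powr \<sigma>) \<beta> (\<lambda>x. \<bar>f x\<bar> powr p);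
                   F = (\<lambda>x. G (enn2real (I x) / Lp_norm p f powr p) * V x)
               in (AE x in lebesgue. x \<in> beta_ball \<beta> y r \<and> V x \<noteq> 0 \<longrightarrow> 0 < I x \<and> I x < \<infinity>) \<and>
                  set_integrable lebesgue (beta_ball \<beta> y r) F \<and>
                  (LINT x:beta_ball \<beta> y r|lebesgue. F x) \<le> \<xi> r)) \<and>
           filterlim (\<lambda>t. G t / t) at_top at_top"
proof -
  note \<phi>_pos = assms(4)
  define \<gamma> where "\<gamma> = (real CARD('n) - p) * (2 * beta_sum \<beta> / real CARD('n))"
  have "0 < \<beta> $ k" for k
    using assms(1)[of k] by simp
  then have \<beta>_sum: "0 < beta_sum \<beta>"
    unfolding beta_sum_def by (intro sum_pos) auto
  then have \<gamma>: "0 < \<gamma>"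
    unfolding \<gamma>_def using assms(3) by simp
  define a where "a = power_profile \<gamma> (\<lambda>t. \<phi> t powr \<sigma>)"
  \<comment> \<open>The factor \<open>1 / 2\<close> cancels the \<open>2\<close> of \<open>beta_S_class_ball_bound\<close>.\<close>
  define c where "c = (\<lambda>t. 1 / 2 * \<phi> t powr (\<sigma> - 1))"
  interpret decreasing_pair c a
    unfolding a_def c_def using \<gamma> assms(4,5,7,12,13)
    by (intro decreasing_pair_power_profile) auto
  let ?K = "\<lambda>x z. beta_kernel p \<phi> \<beta> x z" and ?d = "\<lambda>x z. beta_dist \<beta> x z"
  have kernel_\<sigma>: "beta_kernel p (\<lambda>t. \<phi> t powr \<sigma>) \<beta> x z = a (?d x z)" for x z
    by (simp add: beta_kernel_eq_power_profile a_def \<gamma>_def)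
  \<comment> \<open>This holds on the diagonal too, where both kernels are \<open>0\<close>.\<close>
  have kernel: "c (?d x z) * a (?d x z) = 1 / 2 * ?K x z" for x z
  proof (cases "x = z")
    case True
    then show ?thesis
      by (simp add: beta_dist_def a_def power_profile_def beta_kernel_def)
  next
    case False
    then have "0 < \<phi> (?d x z)"
      by (intro \<phi>_pos beta_dist_pos)
    moreover from this have "\<phi> (?d x z) powr \<sigma> = \<phi> (?d x z) * \<phi> (?d x z) powr (\<sigma> - 1)"
      by (subst powr_mult_base) auto
    ultimately show ?thesis
      by (simp add: c_def a_def power_profile_def beta_kernel_def \<gamma>_def)
  qed

  interpret L: sigma_finite_measure "lebesgue :: (real^'n) measure"
    by (intro sigma_finite_completion sigma_finite_lborel)
  interpret LL: pair_sigma_finite "lebesgue :: (real^'n) measure" "lebesgue :: (real^'n) measure" ..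
  have id: "(\<lambda>x. x) \<in> borel_measurable (lebesgue :: (real^'n) measure)"
    by (intro measurable_completion[of "\<lambda>x. x" lborel]) simp
  note [measurable] = measurable_compose[OF measurable_fst id] measurable_compose[OF measurable_snd id]
  have \<phi>\<sigma>: "continuous_on {0<..} (\<lambda>t. \<phi> t powr \<sigma>)" "\<And>t. 0 < t \<Longrightarrow> 0 < \<phi> t powr \<sigma>"
    using assms(6) \<phi>_pos by (auto intro!: continuous_intros simp: less_imp_neq[symmetric])
  have K_meas [measurable]: "(\<lambda>q. ?K (fst q) (snd q)) \<in> borel_measurable (lebesgue \<Otimes>\<^sub>M lebesgue)"
    by (intro beta_kernel_measurable assms(6) \<phi>_pos) measurable
  have a_meas [measurable]: "(\<lambda>q. a (?d (fst q) (snd q))) \<in> borel_measurable (lebesgue \<Otimes>\<^sub>M lebesgue)"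
    unfolding kernel_\<sigma>[symmetric] by (intro beta_kernel_measurable \<phi>\<sigma>) measurable
  have K_meas1 [measurable]: "(\<lambda>z. ?K x z) \<in> borel_measurable lebesgue" for x
    using measurable_compose[OF measurable_Pair1' K_meas, of x] by simp
  have a_meas1 [measurable]: "(\<lambda>z. a (?d x z)) \<in> borel_measurable lebesgue" for x
    using measurable_compose[OF measurable_Pair1' a_meas, of x] by simp
  have V_meas [measurable]: "V \<in> borel_measurable lebesgue"
    using assms(11) by (simp add: beta_S_class_def)
  have envelope_meas [measurable]: "envelope \<in> borel_measurable borel"
    by (rule borel_measurable_mono[OF mono_envelope])

  have "(AE x in lebesgue. x \<in> beta_ball \<beta> y r \<and> V x \<noteq> 0 \<longrightarrow> 0 < I x \<and> I x < \<infinity>) \<and>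
        set_integrable lebesgue (beta_ball \<beta> y r) F \<and>
        (LINT x:beta_ball \<beta> y r|lebesgue. F x) \<le> \<xi> r"
    if f: "test_function f" "\<exists>x. f x \<noteq> 0" and r: "0 < r"
      and I_def: "I = beta_frac_integral p (\<lambda>t. \<phi> t powr \<sigma>) \<beta> (\<lambda>x. \<bar>f x\<bar> powr p)"
      and F_def: "F = (\<lambda>x. envelope (enn2real (I x) / Lp_norm p f powr p) * V x)"
    for f y r I F
  proof -
    define B where "B = beta_ball \<beta> y r"
    have dist_meas: "(\<lambda>x. ?d y x) \<in> borel_measurable lebesgue"
      by (intro beta_dist_measurable id) auto
    have B [measurable]: "B \<in> sets lebesgue"
      using measurable_sets[OF dist_meas, of "{..<r}"]
      by (simp add: B_def beta_ball_def vimage_def lessThan_def)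
    define g where "g = (\<lambda>x. \<bar>f x\<bar> powr p)"
    have g_cont: "continuous_on UNIV g" and g_int: "integrable lebesgue g"
      unfolding g_def using test_function_powr[OF f(1), of p] assms(2) by auto
    have g_meas [measurable]: "g \<in> borel_measurable lebesgue"
      using g_int by (rule borel_measurable_integrable)
    have g_nonneg: "0 \<le> g x" for x
      by (simp add: g_def)
    define U where "U = {x. 0 < g x}"
    have U: "open U" "U \<noteq> {}"
      unfolding U_def using f(2) open_Collect_less[OF continuous_on_const g_cont, of 0] by (simp_all add: g_def)
    define N where "N = (LINT x|lebesgue. g x)"
    have N_nn: "(\<integral>\<^sup>+ x. ennreal (g x) \<partial>lebesgue) = ennreal N"
      unfolding N_def by (rule nn_integral_eq_integral[OF g_int]) (simp add: g_nonneg)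
    have "0 < (\<integral>\<^sup>+ x. ennreal (g x) \<partial>lebesgue)"
      by (rule nn_integral_pos_of_open[OF g_meas U]) (simp add: U_def)
    then have N: "0 < N" by (simp add: N_nn)
    have Lp: "Lp_norm p f powr p = N"
      using N assms(2) by (simp add: Lp_norm_def powr_powr g_def[symmetric] N_def[symmetric])
    have I: "I x = (\<integral>\<^sup>+ z. ennreal (g z * a (?d x z)) \<partial>lebesgue)" for x
      by (simp add: I_def beta_frac_integral_def kernel_\<sigma> g_def)
    have I_meas [measurable]: "I \<in> borel_measurable lebesgue"
    proof -
      have "(\<lambda>q. ennreal (g (snd q) * a (?d (fst q) (snd q)))) \<in> borel_measurable (lebesgue \<Otimes>\<^sub>M lebesgue)"
        by measurable
      from L.borel_measurable_nn_integral_fst[OF this] show ?thesis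
        by (simp add: I[abs_def])
    qed
    define J where "J x = (\<integral>\<^sup>+ z. ennreal (g z / N * (1 / 2 * ?K x z)) \<partial>lebesgue)" for x

    have dist_pos: "AE z in lebesgue. 0 < ?d x z" for x
      by (intro AE_completion eventually_mono[OF AE_lborel_singleton[of x]] beta_dist_pos) auto
    have I_pos: "0 < I x" for x
      unfolding I
    proof (rule nn_integral_pos_of_open[OF _ U])
      show "AE z in lebesgue. z \<in> U \<longrightarrow> 0 < g z * a (?d x z)"
        using dist_pos[of x] by eventually_elim (auto simp: U_def a_pos)
    qed measurable
    have I_N: "(\<integral>\<^sup>+ z. ennreal (g z / N * a (?d x z)) \<partial>lebesgue) = ennreal (1 / N) * I x" for x
    proof -
      have "(\<integral>\<^sup>+ z. ennreal (g z / N * a (?d x z)) \<partial>lebesgue)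
          = (\<integral>\<^sup>+ z. ennreal (1 / N) * ennreal (g z * a (?d x z)) \<partial>lebesgue)"
        using N by (intro nn_integral_cong) (simp add: ennreal_mult'[symmetric])
      then show ?thesis
        unfolding I by (subst (asm) nn_integral_cmult) auto
    qed
    have weight: "(\<integral>\<^sup>+ z. ennreal (g z / N) \<partial>lebesgue) = 1"
    proof -
      have "(\<integral>\<^sup>+ z. ennreal (g z / N) \<partial>lebesgue) = (\<integral>\<^sup>+ z. ennreal (1 / N) * ennreal (g z) \<partial>lebesgue)"
        using N by (intro nn_integral_cong) (simp add: ennreal_mult'[symmetric])
      also have "\<dots> = ennreal (1 / N) * ennreal N"
        by (subst nn_integral_cmult) (auto simp: N_nn)
      also have "\<dots> = 1"
        using N by (simp add: ennreal_mult'[symmetric])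
      finally show ?thesis .
    qed
    \<comment> \<open>\<open>J\<close> is the mean of \<open>c a\<close>, and \<open>I / N\<close> the mean of \<open>a\<close>, for the density \<open>g / N\<close>.\<close>
    have jensen: "I x < \<infinity> \<and> ennreal (envelope (enn2real (I x) / N)) \<le> J x" if "J x < \<infinity>" for x
    proof -
      have meas: "(\<lambda>z. c (?d x z) * a (?d x z)) \<in> borel_measurable lebesgue"
        unfolding kernel by measurable
      have w: "(\<lambda>z. g z / N) \<in> borel_measurable lebesgue" "\<And>z. 0 \<le> g z / N"
        using N g_nonneg by auto
      have fin: "(\<integral>\<^sup>+ z. ennreal (g z / N * (c (?d x z) * a (?d x z))) \<partial>lebesgue) < \<infinity>"
        unfolding kernel using that by (simp only: J_def)
      note avg = envelope_average[OF w weight dist_pos a_meas1 meas fin]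
      have "I x < \<infinity>"
        using avg(1) N unfolding I_N by (auto simp: ennreal_mult_less_top)
      moreover have "enn2real (ennreal (1 / N) * I x) = enn2real (I x) / N"
        using N by (simp add: enn2real_mult)
      ultimately show ?thesis
        using avg(2) unfolding I_N kernel by (simp add: J_def)
    qed

    have total: "(\<integral>\<^sup>+ x. ennreal (\<bar>V x\<bar> * indicator B x) * J x \<partial>lebesgue) \<le> ennreal (\<xi> r)"
    proof -
      let ?h = "\<lambda>x z. ennreal (\<bar>V x\<bar> * indicator B x) * ennreal (g z / N * (1 / 2 * ?K x z))"
      have K_nonneg: "0 \<le> ?K x z" for x z
      proof (cases "x = z")
        case False
        then show ?thesis
          using \<phi>_pos[OF beta_dist_pos[of x z]] by (simp add: beta_kernel_def less_imp_le)
      qed (simp add: beta_kernel_def beta_dist_def)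
      have "(\<integral>\<^sup>+ x. ennreal (\<bar>V x\<bar> * indicator B x) * J x \<partial>lebesgue)
          = (\<integral>\<^sup>+ x. \<integral>\<^sup>+ z. ?h x z \<partial>lebesgue \<partial>lebesgue)"
        unfolding J_def by (intro nn_integral_cong nn_integral_cmult[symmetric]) measurable
      also have "\<dots> = (\<integral>\<^sup>+ z. \<integral>\<^sup>+ x. ?h x z \<partial>lebesgue \<partial>lebesgue)"
        by (rule LL.Fubini'[symmetric]) (simp add: case_prod_beta')
      also have "\<dots> \<le> (\<integral>\<^sup>+ z. ennreal (\<xi> r) * ennreal (g z / N) \<partial>lebesgue)"
      proof (rule nn_integral_mono)
        fix z :: "real^'n"
        have "?h x z = ennreal (g z / N * (1 / 2)) *
            (ennreal (\<bar>V x\<bar> * ?K z x) * indicator (beta_ball \<beta> y r) x)" for x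
          using N g_nonneg[of z] K_nonneg[of z x]
          by (auto simp: indicator_def B_def ennreal_mult'[symmetric] beta_kernel_commute[of p \<phi> \<beta> x z]
              mult_ac simp del: ennreal_mult)
        then have "(\<integral>\<^sup>+ x. ?h x z \<partial>lebesgue) = ennreal (g z / N * (1 / 2)) *
            (\<integral>\<^sup>+ x\<in>beta_ball \<beta> y r. ennreal (\<bar>V x\<bar> * ?K z x) \<partial>lebesgue)"
          using B by (simp add: nn_integral_cmult B_def)
        also have "\<dots> \<le> ennreal (g z / N * (1 / 2)) * (2 * ennreal (\<xi> r))"
          using \<beta>_sum assms(3) r
          by (intro mult_left_mono beta_S_class_ball_bound assms(11) \<phi>_pos assms(5,6)) auto
        also have "\<dots> = ennreal (\<xi> r) * ennreal (g z / N)"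
        proof -
          have "(2::ennreal) * ennreal (\<xi> r) = ennreal (2 * \<xi> r)"
            using assms(8)[OF r] by (simp add: ennreal_mult)
          then show ?thesis
            using assms(8)[OF r] N g_nonneg[of z] by (simp add: ennreal_mult'[symmetric] mult_ac)
        qed
        finally show "(\<integral>\<^sup>+ x. ?h x z \<partial>lebesgue) \<le> ennreal (\<xi> r) * ennreal (g z / N)" .
      qed
      also have "\<dots> = ennreal (\<xi> r)"
        by (subst nn_integral_cmult) (auto simp: weight)
      finally show ?thesis .
    qed

    have "J \<in> borel_measurable lebesgue"
    proof -
      have "(\<lambda>q. ennreal (g (snd q) / N * (1 / 2 * ?K (fst q) (snd q))))
          \<in> borel_measurable (lebesgue \<Otimes>\<^sub>M lebesgue)"
        by measurable
      from L.borel_measurable_nn_integral_fst[OF this] show ?thesis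
        by (simp add: J_def[abs_def])
    qed
    then have "AE x in lebesgue. ennreal (\<bar>V x\<bar> * indicator B x) * J x \<noteq> \<infinity>"
      using total by (intro nn_integral_noteq_infinite) (auto simp: top_unique)
    then have J_fin: "AE x in lebesgue. x \<in> B \<and> V x \<noteq> 0 \<longrightarrow> J x < \<infinity>"
      by eventually_elim (auto simp: ennreal_mult_eq_top_iff less_top)
    then have range_I: "AE x in lebesgue. x \<in> B \<and> V x \<noteq> 0 \<longrightarrow> 0 < I x \<and> I x < \<infinity>"
      by eventually_elim (use I_pos jensen in blast)
    have F: "F x = envelope (enn2real (I x) / N) * V x" for x
      by (simp add: F_def Lp)
    have F_meas [measurable]: "F \<in> borel_measurable lebesgue"
      unfolding F[abs_def] by measurable
    \<comment> \<open>\<open>V\<close> may change sign, so it is the integral of \<open>\<bar>F\<bar>\<close> that is bounded; this also yields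
        integrability.\<close>
    have bound: "(\<integral>\<^sup>+ x. ennreal (norm (indicator B x *\<^sub>R F x)) \<partial>lebesgue) \<le> ennreal (\<xi> r)"
    proof (rule order_trans[OF nn_integral_mono_AE total], use J_fin in eventually_elim)
      case (elim x)
      show ?case
      proof (cases "x \<in> B \<and> V x \<noteq> 0")
        case True
        then have "J x < \<infinity>" "0 < I x" "I x < \<infinity>"
          using elim I_pos jensen by blast+
        then have "0 < enn2real (I x) / N"
          using N by (simp add: enn2real_positive_iff)
        then have "norm (indicator B x *\<^sub>R F x) = \<bar>V x\<bar> * indicator B x * envelope (enn2real (I x) / N)"
          using True envelope_pos by (simp add: F abs_mult less_imp_le mult.commute)
        then show ?thesis
          using jensen[OF \<open>J x < \<infinity>\<close>] by (simp add: ennreal_mult' mult_left_mono)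
      qed (auto simp: F)
    qed
    have integrable: "set_integrable lebesgue B F"
      unfolding set_integrable_def
      by (rule integrableI_bounded, measurable) (use bound in \<open>auto intro: le_less_trans\<close>)
    have "(LINT x:B|lebesgue. F x) \<le> norm (LINT x:B|lebesgue. F x)"
      by simp
    also have "\<dots> \<le> \<xi> r"
    proof -
      have "ennreal (norm (LINT x:B|lebesgue. F x)) \<le> ennreal (\<xi> r)"
        using integral_norm_bound_ennreal[OF integrable[unfolded set_integrable_def]] bound
        unfolding set_lebesgue_integral_def by (rule order_trans)
      then show ?thesis
        using assms(8)[OF r] by (simp add: ennreal_le_iff)
    qed
    finally show ?thesis
      using range_I integrable unfolding B_def by blast
  qed
  then show ?thesis
    using mono_envelope envelope_pos envelope_superlinear
    by (intro exI[of _ envelope]) (auto simp: Let_def mono_def intro!: mono_onI)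
qed

end
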